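(* Let $K$ be a commutative ring with unity, $R=K[x_1,\dots,x_n]$, $S=K[y_1,\dots,y_m]$, $f\in R$ and $g\in S$. Let $X:(R,f)\to(S,g)$ and $X':(S,g)\to(R,f)$ be $1$-morphisms in $\mathcal{LG}_K$ that are finite rank matrix factorizations (of positive size), i.e. $X$ is a matrix factorization of $g-f$ and $X'$ is a matrix factorization of $f-g$, both over $K[x,y]$. If $X\otimes X'=(P,Q)$ and $X'\otimes X=(P',Q')$, then $$\det(P)=\det(Q)=\det(P')=\det(Q')=0.$$
   Context: Here $x=(x_1,\dots,x_n)$, $y=(y_1,\dots,y_m)$ and $R\otimes_K S\cong K[x,y]$. The objects of the bicategory $\mathcal{LG}_K$ are pairs $(R,f)$ with $f\in R$ a polynomial; a (finite rank) $1$-morphism $(R,f)\to(S,g)$ is a finite rank matrix factorization of $g-f$ over $K[x,y]$. A matrix factorization of size $p$ of an element $h$ of a commutative ring $A$ is a pair $(\phi,\psi)$ of $p\times p$ matrices over $A$ with $\phi\psi=\psi\phi=hI_p$. The tensor product is Yoshino's tensor product: for matrix factorizations $X=(\phi,\psi)$ of size $p$ and $X'=(\phi',\psi')$ of size $q$ over $K[x,y]$, $$X\otimes X'=\left(\begin{bmatrix}\phi\otimes 1_q & 1_p\otimes\phi'\\ -1_p\otimes\psi' & \psi\otimes 1_q\end{bmatrix},\begin{bmatrix}\psi\otimes 1_q & -1_p\otimes\phi'\\ 1_p\otimes\psi' & \phi\otimes 1_q\end{bmatrix}\right),$$ where $\otimes$ between matrices is the Kronecker product over $K[x,y]$ and $1_k$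 is the $k\times k$ identity matrix; $X'\otimes X$ is obtained by exchanging the roles of $X$ and $X'$ (and of $p$ and $q$). *)

theory Defs
  imports "HOL-Library.Poly_Mapping" "Jordan_Normal_Form.Determinant"
begin

(* Monomials are finitely supported exponent functions; a polynomial is a finitely
   supported map from monomials to coefficients, with the convolution product. *)
type_synonym ('v, 'k) mpoly = "('v \<Rightarrow>\<^sub>0 nat) \<Rightarrow>\<^sub>0 'k"

(* K[V] as a subring of the ring of polynomials in all variables of type 'v. *)
definition poly_ring :: "'v set \<Rightarrow> ('v, 'k::comm_ring_1) mpoly set" where
  "poly_ring V = {h. \<forall>u \<in> Poly_Mapping.keys h. Poly_Mapping.keys u \<subseteq> V}"

(* The variables x_i are Inl i and the variables y_j are Inr j, so the two families
   are disjoint, and R and S are subrings of K[x,y]. *)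
definition x_vars :: "nat \<Rightarrow> (nat + nat) set" where
  "x_vars n = Inl ` {1..n}"

definition y_vars :: "nat \<Rightarrow> (nat + nat) set" where
  "y_vars m = Inr ` {1..m}"

definition matrix_factorization ::
  "'r::comm_ring_1 set \<Rightarrow> 'r \<Rightarrow> nat \<Rightarrow> 'r mat \<times> 'r mat \<Rightarrow> bool" where
  "matrix_factorization A h p X \<longleftrightarrow>
     (case X of (\<phi>, \<psi>) \<Rightarrow>
       h \<in> A \<and>
       \<phi> \<in> carrier_mat p p \<and> \<psi> \<in> carrier_mat p p \<and>
       elements_mat \<phi> \<subseteq> A \<and> elements_mat \<psi> \<subseteq> A \<and>
       \<phi> * \<psi> = h \<cdot>\<^sub>m 1\<^sub>m p \<and> \<psi> * \<phi> = h \<cdot>\<^sub>m 1\<^sub>m p)"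

(* An object (K[V], f) is represented by (V, f). *)
definition lg_object :: "'v set \<times> ('v, 'k::comm_ring_1) mpoly \<Rightarrow> bool" where
  "lg_object Rf \<longleftrightarrow> (case Rf of (V, f) \<Rightarrow> finite V \<and> f \<in> poly_ring V)"

(* Finite rank 1-morphisms (K[V], f) \<rightarrow> (K[W], g) of size p. The tensor product of K[V]
   and K[W] over K is K[V \<union> W] only when V and W are disjoint. *)
definition lg_morphism ::
  "'v set \<times> ('v, 'k::comm_ring_1) mpoly \<Rightarrow> 'v set \<times> ('v, 'k) mpoly \<Rightarrow> nat \<Rightarrow>
   ('v, 'k) mpoly mat \<times> ('v, 'k) mpoly mat \<Rightarrow> bool" where
  "lg_morphism Rf Sg p X \<longleftrightarrow>
     lg_object Rf \<and> lg_object Sg \<and>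
     (case (Rf, Sg) of ((V, f), (W, g)) \<Rightarrow>
       V \<inter> W = {} \<and> matrix_factorization (poly_ring (V \<union> W)) (g - f) p X)"

definition kronecker :: "'r::comm_ring_1 mat \<Rightarrow> 'r mat \<Rightarrow> 'r mat" where
  "kronecker A B =
     mat (dim_row A * dim_row B) (dim_col A * dim_col B)
       (\<lambda>(i, j). A $$ (i div dim_row B, j div dim_col B) * B $$ (i mod dim_row B, j mod dim_col B))"

definition yoshino_tensor ::
  "'r::comm_ring_1 mat \<times> 'r mat \<Rightarrow> 'r mat \<times> 'r mat \<Rightarrow> 'r mat \<times> 'r mat" where
  "yoshino_tensor X X' =
     (case (X, X') of ((\<phi>, \<psi>), (\<phi>', \<psi>')) \<Rightarrow>
       let p = dim_row \<phi>; q = dim_row \<phi>' in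
       (four_block_mat
          (kronecker \<phi> (1\<^sub>m q))          (kronecker (1\<^sub>m p) \<phi>')
          (kronecker (- 1\<^sub>m p) \<psi>')      (kronecker \<psi> (1\<^sub>m q)),
        four_block_mat
          (kronecker \<psi> (1\<^sub>m q))          (kronecker (- 1\<^sub>m p) \<phi>')
          (kronecker (1\<^sub>m p) \<psi>')        (kronecker \<phi> (1\<^sub>m q))))"

end

(* The off-diagonal blocks of the tensor product commute with the diagonal ones, so Silvester's
   formula det [[A, B], [C, D]] = det (A D - B C), valid for C D = D C over any commutative ring,
   applies.  Here A D - B C = ((g - f) + (f - g)) I = 0, a matrix of positive size pq.
   The library has the formula over integral domains only, where det D can be made cancellable
   just by being nonzero; in general one replaces D by D + X over the polynomial ring, whose
   determinant is monic and hence not a zero divisor, and then sets X = 0. *)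
theory Submission
  imports Defs "Jordan_Normal_Form.Char_Poly"
begin

section \<open>Determinants of block matrices over a commutative ring\<close>

text \<open>Induction peels off the last row and column: that column is zero above a final 1, so
  expansion along it keeps the determinant.\<close>

lemma det_four_block_mat_one_lower:
  fixes A :: "'a :: comm_ring_1 mat"
  assumes A: "A \<in> carrier_mat n n" and C: "C \<in> carrier_mat m n"
  shows "det (four_block_mat A (0\<^sub>m n m) C (1\<^sub>m m)) = det A"
  using C
proof (induction m arbitrary: C)
  case 0
  have "four_block_mat A (0\<^sub>m n 0) C (1\<^sub>m 0) = A"
    using A 0 by (intro eq_matI) auto
  then show ?case by simp
next
  case (Suc m)
  let ?C = "mat m n (\<lambda>(i, j). C $$ (i, j))"
  \<comment> \<open>The last row of \<open>C\<close>, continued by the zeros of the last row of the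
    identity block.\<close>
  let ?c = "mat 1 (n + m) (\<lambda>(i, j). if j < n then C $$ (m, j) else 0)"
  let ?F = "four_block_mat A (0\<^sub>m n m) ?C (1\<^sub>m m)"
  have F: "?F \<in> carrier_mat (n + m) (n + m)"
    using A by auto
  have "four_block_mat A (0\<^sub>m n (Suc m)) C (1\<^sub>m (Suc m))
      = four_block_mat ?F (0\<^sub>m (n + m) 1) ?c (1\<^sub>m 1)"
  proof (rule eq_matI, goal_cases)
    case (1 i j)
    then have "i < n + m \<or> i = n + m" "j < n + m \<or> j = n + m"
      using A by auto
    then show ?case
      using A Suc.prems by (elim disjE) auto
  qed (use A Suc.prems in auto)
  also have "det \<dots> = det ?F * det (1\<^sub>m 1 :: 'a mat)"
    by (rule det_four_block_mat_upper_right_zero_col[OF F]) auto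
  also have "\<dots> = det A"
    using Suc.IH[of ?C] by simp
  finally show ?case .
qed

text \<open>The mirror image, peeling off the first row and column instead, whence the shift by
  \<open>Suc\<close> in \<open>?B\<close>.\<close>

lemma det_four_block_mat_one_upper:
  fixes D :: "'a :: comm_ring_1 mat"
  assumes D: "D \<in> carrier_mat n n" and B: "B \<in> carrier_mat m n"
  shows "det (four_block_mat (1\<^sub>m m) B (0\<^sub>m n m) D) = det D"
  using B
proof (induction m arbitrary: B)
  case 0
  have "four_block_mat (1\<^sub>m 0) B (0\<^sub>m n 0) D = D"
    using D 0 by (intro eq_matI) auto
  then show ?case by simp
next
  case (Suc m)
  let ?B = "mat m n (\<lambda>(i, j). B $$ (Suc i, j))"
  let ?b = "mat 1 (m + n) (\<lambda>(i, j). if j < m then 0 else B $$ (0, j - m))"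
  let ?F = "four_block_mat (1\<^sub>m m) ?B (0\<^sub>m n m) D"
  have F: "?F \<in> carrier_mat (m + n) (m + n)"
    using D by auto
  have "four_block_mat (1\<^sub>m (Suc m)) B (0\<^sub>m n (Suc m)) D
      = four_block_mat (1\<^sub>m 1) ?b (0\<^sub>m (m + n) 1) ?F"
    using D Suc.prems by (intro eq_matI) (auto simp: Suc_diff_le not_less)
  also have "det \<dots> = det (1\<^sub>m 1 :: 'a mat) * det ?F"
    by (rule det_four_block_mat_lower_left_zero_col[OF _ _ _ F]) auto
  also have "\<dots> = det D"
    using Suc.IH[of ?B] by simp
  finally show ?case .
qed

text \<open>The matrix factors as \<open>?U * ?L\<close>, where each factor has an identity block
  and so falls under one of the two preceding lemmas.\<close>

lemma det_four_block_mat_lower_left_zero_comm_ring: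
  fixes A :: "'a :: comm_ring_1 mat"
  assumes A: "A \<in> carrier_mat n n" and B: "B \<in> carrier_mat n m" and D: "D \<in> carrier_mat m m"
  shows "det (four_block_mat A B (0\<^sub>m m n) D) = det A * det D"
proof -
  let ?U = "four_block_mat (1\<^sub>m n) B (0\<^sub>m m n) D"
  let ?L = "four_block_mat A (0\<^sub>m n m) (0\<^sub>m m n) (1\<^sub>m m)"
  have "?U * ?L = four_block_mat A B (0\<^sub>m m n) D"
    by (subst mult_four_block_mat[OF one_carrier_mat B zero_carrier_mat D
          A zero_carrier_mat zero_carrier_mat one_carrier_mat])
       (use A B D in auto)
  moreover have "det (?U * ?L) = det ?U * det ?L"
    by (rule det_mult[of _ "n + m"]) (use A B D in auto)
  ultimately show ?thesis
    using det_four_block_mat_one_upper[OF D B]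
      det_four_block_mat_one_lower[OF A, of "0\<^sub>m m n" m] by (simp add: mult.commute)
qed

text \<open>Right multiplication by \<open>?N\<close>, of determinant \<open>det D\<close>, turns
  the lower left block into \<open>C * D - D * C\<close>, which vanishes by \<open>comm\<close>. The
  factor \<open>det D\<close> remains to be cancelled.\<close>

lemma det_four_block_mat_mult_det:
  fixes A :: "'a :: comm_ring_1 mat"
  assumes A: "A \<in> carrier_mat n n" and B: "B \<in> carrier_mat n n"
    and C: "C \<in> carrier_mat n n" and D: "D \<in> carrier_mat n n"
    and comm: "C * D = D * C"
  shows "det (four_block_mat A B C D) * det D = det (A * D - B * C) * det D"
proof -
  let ?M = "four_block_mat A B C D"
  let ?N = "four_block_mat D (0\<^sub>m n n) (- C) (1\<^sub>m n)"
  have "det ?M * det ?N = det (?M * ?N)"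
    by (rule det_mult[symmetric, of _ "n + n"]) (use A B C D in auto)
  also have "?M * ?N = four_block_mat (A * D - B * C) B (0\<^sub>m n n) D"
    by (subst mult_four_block_mat[OF A B C D D]) (use A B C D in \<open>auto simp: comm\<close>)
  also have "det \<dots> = det (A * D - B * C) * det D"
    by (rule det_four_block_mat_lower_left_zero_comm_ring) (use A B C D in auto)
  also have "det ?N = det D"
    by (rule det_four_block_mat_one_lower[OF D]) (use C in auto)
  finally show ?thesis .
qed

text \<open>The top coefficient of \<open>(a - b) * c\<close> is that of \<open>a - b\<close> times
  1, so zero divisors among the coefficients cannot kill it.\<close>

lemma monic_mult_right_cancel:
  fixes a b c :: "'a :: comm_ring_1 poly"
  assumes "a * c = b * c" and "lead_coeff c = 1"
  shows "a = b"
proof (rule ccontr)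
  assume "a \<noteq> b"
  moreover have "coeff ((a - b) * c) (degree (a - b) + degree c) = lead_coeff (a - b)"
    unfolding coeff_mult_degree_sum assms(2) by simp
  moreover have "(a - b) * c = 0"
    using assms(1) by (simp add: left_diff_distrib)
  ultimately show False
    by (metis coeff_0 leading_coeff_0_iff right_minus_eq)
qed

lemma det_four_block_mat_comm_ring:
  fixes A :: "'a :: comm_ring_1 mat"
  assumes A: "A \<in> carrier_mat n n" and B: "B \<in> carrier_mat n n"
    and C: "C \<in> carrier_mat n n" and D: "D \<in> carrier_mat n n"
    and comm: "C * D = D * C"
  shows "det (four_block_mat A B C D) = det (A * D - B * C)"
proof -
  \<comment> \<open>\<open>?l\<close> embeds matrices as constant polynomials and \<open>?e\<close>
    sets the variable to 0, which undoes \<open>?l\<close> and sends \<open>Dx\<close> back to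
    \<open>D\<close>.\<close>
  let ?l = "map_mat (\<lambda>a :: 'a. [:a:])"
  let ?e = "map_mat (\<lambda>p :: 'a poly. poly p 0)"
  let ?X = "[:0, 1:] \<cdot>\<^sub>m 1\<^sub>m n :: 'a poly mat"
  define Dx where "Dx = ?X + ?l D"
  have car: "?l A \<in> carrier_mat n n" "?l B \<in> carrier_mat n n" "?l C \<in> carrier_mat n n"
    "?l D \<in> carrier_mat n n" "?X \<in> carrier_mat n n" "Dx \<in> carrier_mat n n"
    using A B C D by (auto simp: Dx_def)
  have lift_mult: "?l (S * T) = ?l S * ?l T"
    if "S \<in> carrier_mat n n" "T \<in> carrier_mat n n" for S T
    by (rule map_poly_mult(1)[OF that])
  \<comment> \<open>Commutation survives the perturbation because \<open>?X\<close> is a scalar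
    matrix.\<close>
  have "?l C * Dx = ?l C * ?X + ?l C * ?l D"
    unfolding Dx_def by (rule mult_add_distrib_mat) (use car in auto)
  also have "?l C * ?l D = ?l D * ?l C"
    using lift_mult[OF C D] lift_mult[OF D C] comm by simp
  also have "?l C * ?X = ?X * ?l C"
    using car by auto
  also have "?X * ?l C + ?l D * ?l C = Dx * ?l C"
    unfolding Dx_def by (rule add_mult_distrib_mat[symmetric]) (use car in auto)
  finally have comm': "?l C * Dx = Dx * ?l C" .
  \<comment> \<open>The sign makes \<open>Dx\<close> a characteristic matrix, so its determinant is
    monic.\<close>
  have "Dx = char_poly_matrix (- D)"
    using D by (auto simp: Dx_def char_poly_matrix_def)
  then have "det Dx = char_poly (- D)"
    by (simp add: char_poly_def)
  then have "lead_coeff (det Dx) = 1"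
    using degree_monic_char_poly[of "- D" n] D by auto
  with det_four_block_mat_mult_det[OF car(1-3,6) comm']
  have "det (four_block_mat (?l A) (?l B) (?l C) Dx) = det (?l A * Dx - ?l B * ?l C)"
    by (rule monic_mult_right_cancel)
  \<comment> \<open>Evaluation at 0 is a ring homomorphism, hence commutes with \<open>det\<close>
    and with the block operations.\<close>
  then have "det (?e (four_block_mat (?l A) (?l B) (?l C) Dx)) = det (?e (?l A * Dx - ?l B * ?l C))"
    by (simp only: comm_ring_hom.hom_det[OF poly_hom.comm_ring_hom_axioms])
  moreover have eval: "?e (?l S) = S" for S
    by (intro eq_matI) auto
  have eval_Dx: "?e Dx = D"
    using D by (intro eq_matI) (auto simp: Dx_def)
  have "?e (four_block_mat (?l A) (?l B) (?l C) Dx) = four_block_mat A B C D"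
    by (subst map_four_block_mat[OF car(1-3,6)]) (simp add: eval eval_Dx)
  moreover have "?e (?l A * Dx - ?l B * ?l C) = ?e (?l A * Dx) - ?e (?l B * ?l C)"
    using car by (intro eq_matI) auto
  moreover have "?e (?l A * Dx) = A * D"
    by (subst semiring_hom.mat_hom_mult[OF poly_hom.semiring_hom_axioms car(1,6)]) (simp add: eval eval_Dx)
  moreover have "?e (?l B * ?l C) = B * C"
    by (subst semiring_hom.mat_hom_mult[OF poly_hom.semiring_hom_axioms car(2,3)]) (simp add: eval)
  ultimately show ?thesis
    by (simp only:)
qed

section \<open>Kronecker products\<close>

lemma kronecker_carrier [simp]:
  "A \<in> carrier_mat a b \<Longrightarrow> B \<in> carrier_mat c d \<Longrightarrow> kronecker A B \<in> carrier_mat (a * c) (b * d)"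
  by (auto simp: kronecker_def)

text \<open>The mixed-product rule: writing the summation index as \<open>l + k * d\<close> with
  \<open>l < d\<close> splits the sum into a product of two scalar products.\<close>

lemma kronecker_mult:
  assumes A: "A \<in> carrier_mat a b" and B: "B \<in> carrier_mat c d"
    and A': "A' \<in> carrier_mat b a'" and B': "B' \<in> carrier_mat d c'"
  shows "kronecker A B * kronecker A' B' = kronecker (A * A') (B * B')"
proof (rule eq_matI)
  fix i j
  assume "i < dim_row (kronecker (A * A') (B * B'))" "j < dim_col (kronecker (A * A') (B * B'))"
  then have ij: "i < a * c" "j < a' * c'"
    using A B A' B' by (auto simp: kronecker_def)
  then have pos: "c > 0" "c' > 0"
    by (auto intro: Nat.gr0I)
  have lt: "i div c < a" "i mod c < c" "j div c' < a'" "j mod c' < c'"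
    using ij pos by (auto simp: less_mult_imp_div_less)
  let ?f = "\<lambda>k. A $$ (i div c, k div d) * B $$ (i mod c, k mod d) *
    (A' $$ (k div d, j div c') * B' $$ (k mod d, j mod c'))"
  have "(kronecker A B * kronecker A' B') $$ (i, j) = (\<Sum>k<b * d. ?f k)"
    using A B A' B' ij by (auto simp: kronecker_def scalar_prod_def atLeast0LessThan)
  also have "\<dots> = (\<Sum>k<b. \<Sum>l\<in>{k * d..<k * d + d}. ?f l)"
    by (rule sum.nat_group[symmetric])
  also have "\<dots> = (\<Sum>k<b. \<Sum>l<d. ?f (l + k * d))"
  proof (rule sum.cong[OF refl])
    fix k
    show "(\<Sum>l\<in>{k * d..<k * d + d}. ?f l) = (\<Sum>l<d. ?f (l + k * d))"
      using sum.shift_bounds_nat_ivl[of ?f 0 "k * d" d]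
      by (simp only: add.commute[of d] add_0 atLeast0LessThan)
  qed
  also have "\<dots> = (\<Sum>k<b. \<Sum>l<d. A $$ (i div c, k) * A' $$ (k, j div c') *
      (B $$ (i mod c, l) * B' $$ (l, j mod c')))"
    by (intro sum.cong refl) (auto simp: ac_simps)
  also have "\<dots> = (A * A') $$ (i div c, j div c') * (B * B') $$ (i mod c, j mod c')"
    using A B A' B' lt by (simp add: scalar_prod_def atLeast0LessThan sum_product)
  also have "\<dots> = kronecker (A * A') (B * B') $$ (i, j)"
    using A B A' B' ij by (simp add: kronecker_def)
  finally show "(kronecker A B * kronecker A' B') $$ (i, j) = kronecker (A * A') (B * B') $$ (i, j)" .
qed (use A B A' B' in \<open>auto simp: kronecker_def\<close>)

text \<open>Quotient and remainder by \<open>q\<close> determine the index, so a product of two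
  Kronecker deltas is again one.\<close>

lemma kronecker_smult_one_left: "kronecker (h \<cdot>\<^sub>m 1\<^sub>m p) (1\<^sub>m q) = h \<cdot>\<^sub>m 1\<^sub>m (p * q)"
  and kronecker_smult_one_right: "kronecker (1\<^sub>m p) (h \<cdot>\<^sub>m 1\<^sub>m q) = h \<cdot>\<^sub>m 1\<^sub>m (p * q)"
proof -
  have lt: "i div q < p" "i mod q < q" if "i < p * q" for i
    using that by (cases "q = 0"; simp add: less_mult_imp_div_less)+
  have neq: "i div q \<noteq> j div q \<or> i mod q \<noteq> j mod q" if "i \<noteq> j" for i j
    using that by (metis div_mult_mod_eq)
  have entry: "(h \<cdot>\<^sub>m 1\<^sub>m p) $$ (i div q, j div q) * 1\<^sub>m q $$ (i mod q, j mod q) = (if i = j then h else 0)"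
    "1\<^sub>m p $$ (i div q, j div q) * (h \<cdot>\<^sub>m 1\<^sub>m q) $$ (i mod q, j mod q) = (if i = j then h else 0)"
    if "i < p * q" "j < p * q" for i j
    using lt[OF that(1)] lt[OF that(2)] neq[of i j] by auto
  show "kronecker (h \<cdot>\<^sub>m 1\<^sub>m p) (1\<^sub>m q) = h \<cdot>\<^sub>m 1\<^sub>m (p * q)"
    "kronecker (1\<^sub>m p) (h \<cdot>\<^sub>m 1\<^sub>m q) = h \<cdot>\<^sub>m 1\<^sub>m (p * q)"
    \<comment> \<open>Entries of \<open>h \<cdot>\<^sub>m 1\<^sub>m p\<close> must stay folded until
      \<open>entry\<close> has rewritten them.\<close>
    by (intro eq_matI; simp add: kronecker_def entry del: index_smult_mat(1); simp)+
qed

text \<open>Moving the sign to the second factor gives both matrices of the tensor product the same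
  block shape.\<close>

lemma kronecker_uminus_one: "kronecker (- 1\<^sub>m p) B = kronecker (1\<^sub>m p) (- B)"
proof (rule eq_matI)
  fix i j
  assume "i < dim_row (kronecker (1\<^sub>m p) (- B))" "j < dim_col (kronecker (1\<^sub>m p) (- B))"
  then have ij: "i < p * dim_row B" "j < p * dim_col B"
    by (auto simp: kronecker_def)
  then have "dim_row B > 0" "dim_col B > 0"
    by (auto intro: Nat.gr0I)
  with ij show "kronecker (- 1\<^sub>m p) B $$ (i, j) = kronecker (1\<^sub>m p) (- B) $$ (i, j)"
    by (simp add: kronecker_def less_mult_imp_div_less)
qed (auto simp: kronecker_def)

section \<open>Vanishing for the tensor product\<close>

lemma det_tensor_block_eq_0:
  fixes \<alpha> \<beta> \<gamma> \<delta> :: "'a :: comm_ring_1 mat"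
  assumes pq: "p > 0" "q > 0"
    and car: "\<alpha> \<in> carrier_mat p p" "\<delta> \<in> carrier_mat p p"
      "\<beta> \<in> carrier_mat q q" "\<gamma> \<in> carrier_mat q q"
    and ad: "\<alpha> * \<delta> = h \<cdot>\<^sub>m 1\<^sub>m p" and bc: "\<beta> * \<gamma> = h \<cdot>\<^sub>m 1\<^sub>m q"
  shows "det (four_block_mat (kronecker \<alpha> (1\<^sub>m q)) (kronecker (1\<^sub>m p) \<beta>)
    (kronecker (1\<^sub>m p) \<gamma>) (kronecker \<delta> (1\<^sub>m q))) = 0"
proof -
  let ?A = "kronecker \<alpha> (1\<^sub>m q)" and ?B = "kronecker (1\<^sub>m p) \<beta>"
  let ?C = "kronecker (1\<^sub>m p) \<gamma>" and ?D = "kronecker \<delta> (1\<^sub>m q)"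
  \<comment> \<open>By the mixed-product rule both sides are
    \<open>kronecker \<delta> \<gamma>\<close>.\<close>
  have "?C * ?D = ?D * ?C"
    using car by (simp add: kronecker_mult[of _ p p _ q q _ p _ q])
  then have "det (four_block_mat ?A ?B ?C ?D) = det (?A * ?D - ?B * ?C)"
    using car by (intro det_four_block_mat_comm_ring[of _ "p * q"]) auto
  also have "?A * ?D = h \<cdot>\<^sub>m 1\<^sub>m (p * q)"
    using car by (simp add: kronecker_mult[of _ p p _ q q _ p _ q] ad kronecker_smult_one_left)
  also have "?B * ?C = h \<cdot>\<^sub>m 1\<^sub>m (p * q)"
    using car by (simp add: kronecker_mult[of _ p p _ q q _ p _ q] bc kronecker_smult_one_right)
  also have "h \<cdot>\<^sub>m 1\<^sub>m (p * q) - h \<cdot>\<^sub>m 1\<^sub>m (p * q) = (0\<^sub>m (p * q) (p * q) :: 'a mat)"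
    by (intro eq_matI) auto
  \<comment> \<open>Positive size matters: the empty matrix has determinant 1.\<close>
  also have "det \<dots> = 0"
    using pq by (intro det_zero) simp
  finally show ?thesis .
qed

lemma det_yoshino_tensor_eq_0:
  assumes pq: "p > 0" "q > 0"
    and X: "matrix_factorization A h p X" and X': "matrix_factorization A' (- h) q X'"
    and PQ: "yoshino_tensor X X' = (P, Q)"
  shows "det P = 0" and "det Q = 0"
proof -
  obtain \<phi> \<psi> \<phi>' \<psi>' where XX': "X = (\<phi>, \<psi>)" "X' = (\<phi>', \<psi>')"
    by (metis surj_pair)
  have car: "\<phi> \<in> carrier_mat p p" "\<psi> \<in> carrier_mat p p" "\<phi>' \<in> carrier_mat q q" "\<psi>' \<in> carrier_mat q q"
    and prods: "\<phi> * \<psi> = h \<cdot>\<^sub>m 1\<^sub>m p" "\<psi> * \<phi> = h \<cdot>\<^sub>m 1\<^sub>m p" "\<phi>' * \<psi>' = (- h) \<cdot>\<^sub>m 1\<^sub>m q"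
    using X X' by (auto simp: XX' matrix_factorization_def)
  \<comment> \<open>The sign in the off-diagonal blocks turns \<open>- h\<close> into
    \<open>h\<close>, so that the diagonal and off-diagonal products agree.\<close>
  have neg: "\<phi>' * (- \<psi>') = h \<cdot>\<^sub>m 1\<^sub>m q" "- \<phi>' * \<psi>' = h \<cdot>\<^sub>m 1\<^sub>m q"
    using car prods by (auto intro!: eq_matI)
  have P: "P = four_block_mat (kronecker \<phi> (1\<^sub>m q)) (kronecker (1\<^sub>m p) \<phi>')
      (kronecker (1\<^sub>m p) (- \<psi>')) (kronecker \<psi> (1\<^sub>m q))"
    and Q: "Q = four_block_mat (kronecker \<psi> (1\<^sub>m q)) (kronecker (1\<^sub>m p) (- \<phi>'))
      (kronecker (1\<^sub>m p) \<psi>') (kronecker \<phi> (1\<^sub>m q))"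
    using PQ car by (auto simp: XX' yoshino_tensor_def kronecker_uminus_one)
  show "det P = 0"
    unfolding P by (rule det_tensor_block_eq_0[OF pq]) (use car prods neg in auto)
  show "det Q = 0"
    unfolding Q by (rule det_tensor_block_eq_0[OF pq]) (use car prods neg in auto)
qed

theorem theoremB:
  fixes n m p q :: nat
    and f g :: "(nat + nat, 'k::comm_ring_1) mpoly"
    and X X' :: "(nat + nat, 'k) mpoly mat \<times> (nat + nat, 'k) mpoly mat"
    and P Q P' Q' :: "(nat + nat, 'k) mpoly mat"
  assumes "f \<in> poly_ring (x_vars n)"
    and "g \<in> poly_ring (y_vars m)"
    and "p > 0" and "q > 0"
    and "lg_morphism (x_vars n, f) (y_vars m, g) p X"
    and "lg_morphism (y_vars m, g) (x_vars n, f) q X'"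
    and "yoshino_tensor X X' = (P, Q)"
    and "yoshino_tensor X' X = (P', Q')"
  shows "det P = 0 \<and> det Q = 0 \<and> det P' = 0 \<and> det Q' = 0"
proof -
  have X: "matrix_factorization (poly_ring (x_vars n \<union> y_vars m)) (g - f) p X"
    and X': "matrix_factorization (poly_ring (y_vars m \<union> x_vars n)) (f - g) q X'"
    using assms by (auto simp: lg_morphism_def)
  show ?thesis
    \<comment> \<open>Here \<open>h\<close> is \<open>g - f\<close> for the first product and
      \<open>f - g\<close> for the second; the open premise asks for a factorization of
      \<open>- h\<close>.\<close>
    using det_yoshino_tensor_eq_0[OF \<open>p > 0\<close> \<open>q > 0\<close> X _ assms(7)]
      det_yoshino_tensor_eq_0[OF \<open>q > 0\<close> \<open>p > 0\<close> X' _ assms(8)] X X'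
    by simp
qed

end
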